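(* Let $\mathscr{M}=\bigcup_{k\in\mathbb{N}_0}\mathscr{M}_k$ be a finitely $1$-generated $\mathbb{N}_0$-graded monoid, let $(X,d)$ be a complete metric space and let $\alpha\colon\mathscr{M}\to C(X,X)$ be a contracting representation of $\mathscr{M}$. Then for any point $x\in X$, $\alpha$ induces a continuous map $$\kappa_x\colon\partial\mathscr{M}\longrightarrow K(\alpha),\qquad \kappa_x([f])=\lim_{n\to\infty}\alpha(f(n))(x)\quad\text{for } f \text{ a strictly decreasing representative},$$ where $\partial\mathscr{M}$ carries the cone topology and $K(\alpha)$ is the attractor of $\alpha$. Moreover, if $\mathscr{M}$ is $\mathcal{T}$-regular, then $\kappa_x$ is surjective.
   Context: Monoids. An $\mathbb{N}_0$-graded monoid is a monoid $\mathscr{M}$ with a monoid homomorphism $|\cdot|\colon\mathscr{M}\to\mathbb{N}_0$; $\mathscr{M}_k=\{x: |x|=k\}$. It is finitely $1$-generated if $\mathscr{M}_1$ is finite and the canonical homomorphism from the free monoid on $\mathscr{M}_1$ to $\mathscr{M}$ is surjective. For $x,y\in\mathscr{M}$ put $x\preceq y$ iff $x\mathscr{M}\subseteq y\mathscr{M}$; for $1$-generated monoids this is a partial order. Completion and universal boundary. For a poset $(X,\preceq)$ let $\mathscr{D}(\mathbb{N},X,\preceq)$ be the set of functions $f\colon\mathbb{N}\to X$ with $f(n)\succeq f(m)$ whenever $n\le m$. For $u,v$ in it put $u\preceq v$ iff for all $n$ there is $k_n$ with $u(k_n)\preceq v(n)$. Write $\min(u)$ for the (unique, if existing) greatest $z\in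 X$ with $u(n)\succeq z$ for all $n$; $c_z$ is the constant function $z$. Put $u\sim v$ iff ($u\preceq v$ and $v\preceq u$) or ($v\preceq u$ and $v=c_m$ with $m=\min(u)$); let $\approx$ be the equivalence relation generated by $\sim$, $\bar X=\mathscr{D}(\mathbb{N},X,\preceq)/\!\approx$, with $[u]\preceq[v]$ iff $u\preceq v$. $X$ is regarded as a subset of $\bar X$ via $x\mapsto[c_x]$, and $\partial X=\bar X\setminus X$. Every element of $\partial X$ has a strictly decreasing representative ($f(n+1)\prec f(n)$ for all $n$). Topologies. For $\tau\in X$ let $C_\tau(\bar X)=\{x\in\bar X: x\preceq\tau\}$. The cone topology $\mathcal{T}_c(\bar X)$ has as base all sets $\{\tau\}$, $C_\tau(\bar X)$, $\tau\in X$. The fine topology $\mathcal{T}_f(\bar X)$ has as subbasis all sets $\{\tau\}$, $C_\tau(\bar X)$, $\bar X\setminus C_\tau(\bar X)$, $\tau\in X$. $\partial X$ carries the respective subspace topologies. The monoid $\mathscr{M}$ is $\mathcal{T}$-regular if $\mathrm{id}\colon(\partial\mathscr{M},\mathcal{T}_f(\bar{\mathscr{M}}))\to(\partial\mathscr{M},\mathcal{T}_c(\bar{\mathscr{M}}))$ is a homeomorphism. Contracting representations. $C(X,X)$ is the monoid of continuous self-maps of the metric space $X$; a representation is a left action $\alpha\colon\mathscr{M}\to C(X,X)$ (a monoid homomorphism). It is contracting if there is a real number $0<\delta<1$ with $d(\alpha(s)(x),\alpha(s)(y))\le\delta\, d(x,y)$ for all $x,y\in X$, $s\in\mathscr{M}_1$.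 The attractor $K(\alpha)\subseteq X$ is the unique (nonempty) compact subset $K$ with $K=\bigcup_{s\in\mathscr{M}_1}\alpha(s)(K)$; it is also the closure of the set of fixed points of the maps $\alpha(t)$, $t\in\mathscr{M}\setminus\{1\}$. *)

theory Defs
  imports "HOL-Analysis.Analysis"
begin

section \<open>Graded monoids\<close>

definition graded_monoid :: "('m::monoid_mult \<Rightarrow> nat) \<Rightarrow> bool" where
  "graded_monoid deg \<longleftrightarrow> deg 1 = 0 \<and> (\<forall>x y. deg (x * y) = deg x + deg y)"

definition graded_piece :: "('m \<Rightarrow> nat) \<Rightarrow> nat \<Rightarrow> 'm set" where
  "graded_piece deg k = {x. deg x = k}"

text \<open>The free monoid on a set \<open>S\<close> is \<open>lists S\<close>; its canonical homomorphism to the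
  monoid is \<^const>\<open>prod_list\<close>.\<close>

definition finitely_1_generated :: "('m::monoid_mult \<Rightarrow> nat) \<Rightarrow> bool" where
  "finitely_1_generated deg \<longleftrightarrow>
     finite (graded_piece deg 1) \<and> prod_list ` lists (graded_piece deg 1) = UNIV"

definition monoid_le :: "'m::monoid_mult \<Rightarrow> 'm \<Rightarrow> bool" where
  "monoid_le x y \<longleftrightarrow> range ((*) x) \<subseteq> range ((*) y)"


section \<open>Completion and boundary of a poset\<close>

text \<open>The poset is the whole type \<open>'a\<close> with the order relation \<open>le\<close>, which is an explicit
  parameter. Sequences are indexed from 0.\<close>

definition decreasing_seqs :: "('a \<Rightarrow> 'a \<Rightarrow> bool) \<Rightarrow> (nat \<Rightarrow> 'a) set" where
  "decreasing_seqs le = {f. \<forall>n m. n \<le> m \<longrightarrow> le (f m) (f n)}"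

definition strictly_decreasing :: "('a \<Rightarrow> 'a \<Rightarrow> bool) \<Rightarrow> (nat \<Rightarrow> 'a) \<Rightarrow> bool" where
  "strictly_decreasing le f \<longleftrightarrow> (\<forall>n. le (f (Suc n)) (f n) \<and> f (Suc n) \<noteq> f n)"

definition seq_le :: "('a \<Rightarrow> 'a \<Rightarrow> bool) \<Rightarrow> (nat \<Rightarrow> 'a) \<Rightarrow> (nat \<Rightarrow> 'a) \<Rightarrow> bool" where
  "seq_le le u v \<longleftrightarrow> (\<forall>n. \<exists>k. le (u k) (v n))"

definition is_seq_min :: "('a \<Rightarrow> 'a \<Rightarrow> bool) \<Rightarrow> 'a \<Rightarrow> (nat \<Rightarrow> 'a) \<Rightarrow> bool" where
  "is_seq_min le m u \<longleftrightarrow>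
     (\<forall>n. le m (u n)) \<and> (\<forall>z. (\<forall>n. le z (u n)) \<longrightarrow> le z m)"

definition seq_sim :: "('a \<Rightarrow> 'a \<Rightarrow> bool) \<Rightarrow> (nat \<Rightarrow> 'a) \<Rightarrow> (nat \<Rightarrow> 'a) \<Rightarrow> bool" where
  "seq_sim le u v \<longleftrightarrow>
     u \<in> decreasing_seqs le \<and> v \<in> decreasing_seqs le \<and>
     (seq_le le u v \<and> seq_le le v u \<or>
      seq_le le v u \<and> (\<exists>m. is_seq_min le m u \<and> v = (\<lambda>_. m)))"

definition seq_equiv :: "('a \<Rightarrow> 'a \<Rightarrow> bool) \<Rightarrow> ((nat \<Rightarrow> 'a) \<times> (nat \<Rightarrow> 'a)) set" where
  "seq_equiv le =
     {(u, v). u \<in> decreasing_seqs le \<and> v \<in> decreasing_seqs le \<and> equivclp (seq_sim le) u v}"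

definition poset_bar :: "('a \<Rightarrow> 'a \<Rightarrow> bool) \<Rightarrow> (nat \<Rightarrow> 'a) set set" where
  "poset_bar le = decreasing_seqs le // seq_equiv le"

text \<open>For a general poset \<^const>\<open>seq_le\<close> need not be independent of representatives: if \<open>u\<close>
  has a minimum \<open>m\<close> that it does not attain, then \<open>u\<close> and \<open>\<lambda>_. m\<close> are equivalent, but
  \<open>seq_le le u (\<lambda>_. m)\<close> fails. Hence some pair of representatives is required to be comparable.
  In a 1-generated graded monoid an attained minimum is the only kind there is, and all choices
  of representatives give the same result.\<close>

definition bar_le :: "('a \<Rightarrow> 'a \<Rightarrow> bool) \<Rightarrow> (nat \<Rightarrow> 'a) set \<Rightarrow> (nat \<Rightarrow> 'a) set \<Rightarrow> bool" where
  "bar_le le A B \<longleftrightarrow> (\<exists>u\<in>A. \<exists>v\<in>B. seq_le le u v)"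

definition bar_embed :: "('a \<Rightarrow> 'a \<Rightarrow> bool) \<Rightarrow> 'a \<Rightarrow> (nat \<Rightarrow> 'a) set" where
  "bar_embed le x = seq_equiv le `` {\<lambda>_. x}"

definition poset_boundary :: "('a \<Rightarrow> 'a \<Rightarrow> bool) \<Rightarrow> (nat \<Rightarrow> 'a) set set" where
  "poset_boundary le = poset_bar le - range (bar_embed le)"

definition bar_cone :: "('a \<Rightarrow> 'a \<Rightarrow> bool) \<Rightarrow> 'a \<Rightarrow> (nat \<Rightarrow> 'a) set set" where
  "bar_cone le t = {A \<in> poset_bar le. bar_le le A (bar_embed le t)}"


section \<open>Cone and fine topology\<close>

definition cone_topology :: "('a \<Rightarrow> 'a \<Rightarrow> bool) \<Rightarrow> (nat \<Rightarrow> 'a) set topology" where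
  "cone_topology le = topology_generated_by
     (range (\<lambda>t. {bar_embed le t}) \<union> range (bar_cone le))"

definition fine_topology :: "('a \<Rightarrow> 'a \<Rightarrow> bool) \<Rightarrow> (nat \<Rightarrow> 'a) set topology" where
  "fine_topology le = topology_generated_by
     (range (\<lambda>t. {bar_embed le t}) \<union> range (bar_cone le) \<union>
      range (\<lambda>t. poset_bar le - bar_cone le t))"

definition cone_boundary :: "('a \<Rightarrow> 'a \<Rightarrow> bool) \<Rightarrow> (nat \<Rightarrow> 'a) set topology" where
  "cone_boundary le = subtopology (cone_topology le) (poset_boundary le)"

definition fine_boundary :: "('a \<Rightarrow> 'a \<Rightarrow> bool) \<Rightarrow> (nat \<Rightarrow> 'a) set topology" where
  "fine_boundary le = subtopology (fine_topology le) (poset_boundary le)"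

definition T_regular :: "('a \<Rightarrow> 'a \<Rightarrow> bool) \<Rightarrow> bool" where
  "T_regular le \<longleftrightarrow> homeomorphic_map (fine_boundary le) (cone_boundary le) id"


section \<open>Contracting representations\<close>

definition continuous_representation ::
    "('m::monoid_mult \<Rightarrow> 'x::topological_space \<Rightarrow> 'x) \<Rightarrow> bool" where
  "continuous_representation \<alpha> \<longleftrightarrow>
     (\<forall>s. continuous_on UNIV (\<alpha> s)) \<and> \<alpha> 1 = id \<and> (\<forall>s t. \<alpha> (s * t) = \<alpha> s \<circ> \<alpha> t)"

definition contracting ::
    "('m \<Rightarrow> nat) \<Rightarrow> ('m \<Rightarrow> 'x::metric_space \<Rightarrow> 'x) \<Rightarrow> bool" where
  "contracting deg \<alpha> \<longleftrightarrow>
     (\<exists>\<delta>::real. 0 < \<delta> \<and> \<delta> < 1 \<and>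
        (\<forall>s\<in>graded_piece deg 1. \<forall>x y. dist (\<alpha> s x) (\<alpha> s y) \<le> \<delta> * dist x y))"

text \<open>The attractor is nonempty, except for the trivial monoid, which has no generators: then
  the fixed point equation forces the empty set, which is also the closure of the (empty) set of
  fixed points of the maps \<open>\<alpha> t\<close> with \<open>t \<noteq> 1\<close>.\<close>

definition attractor ::
    "('m \<Rightarrow> nat) \<Rightarrow> ('m \<Rightarrow> 'x::metric_space \<Rightarrow> 'x) \<Rightarrow> 'x set" where
  "attractor deg \<alpha> =
     (THE K. compact K \<and> (graded_piece deg 1 \<noteq> {} \<longrightarrow> K \<noteq> {}) \<and>
        K = (\<Union>s\<in>graded_piece deg 1. \<alpha> s ` K))"

definition boundary_map ::
    "('m::monoid_mult \<Rightarrow> 'x::metric_space \<Rightarrow> 'x) \<Rightarrow> 'x \<Rightarrow> (nat \<Rightarrow> 'm) set \<Rightarrow> 'x" where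
  "boundary_map \<alpha> x A =
     (THE y. \<exists>f\<in>A. strictly_decreasing monoid_le f \<and> (\<lambda>n. \<alpha> (f n) x) \<longlonglongrightarrow> y)"

end

theory Submission
  imports Defs
begin

text \<open>A word \<open>t\<close> of length \<open>n\<close> acts as a \<open>\<delta> ^ n\<close>-contraction and orbits are bounded, so whenever
  \<open>u \<preceq> t\<close> the point \<open>\<alpha> u x\<close> lies within \<open>\<delta> ^ n * R\<close> of \<open>\<alpha> t x\<close>. Degrees tend to infinity along
  representatives of boundary points; this yields convergence, independence of the
  representative and, since the cones are neighbourhoods, continuity. Unfolding
  \<open>K = (\<Union>s. \<alpha> s ` K)\<close> repeatedly from a point \<open>y\<close> of the attractor produces an infinite word
  whose prefixes form a strictly decreasing sequence with limit \<open>y\<close>. The attractor itself is the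
  closure of the orbit of the fixed point of a single generator.\<close>

section \<open>Degrees and sequences in 1-generated monoids\<close>

locale fg_graded_monoid =
  fixes deg :: "'m::monoid_mult \<Rightarrow> nat"
  assumes graded: "graded_monoid deg"
    and generated: "finitely_1_generated deg"
begin

abbreviation gens :: "'m set" where
  "gens \<equiv> graded_piece deg 1"

lemma deg_one [simp]: "deg 1 = 0"
  and deg_mult [simp]: "deg (x * y) = deg x + deg y"
  using graded by (auto simp: graded_monoid_def)

lemma deg_gen: "s \<in> gens \<Longrightarrow> deg s = 1"
  by (simp add: graded_piece_def)

lemma finite_gens: "finite gens"
  using generated by (simp add: finitely_1_generated_def)

text \<open>Surjectivity of \<open>prod_list\<close> on words in the generators turns list induction
  into induction on monoid elements, with letters added on the left.\<close>

lemma gens_induct [case_names one mult]: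
  assumes "P 1" and step: "\<And>s t. s \<in> gens \<Longrightarrow> P t \<Longrightarrow> P (s * t)"
  shows "P t"
proof -
  have "t \<in> prod_list ` lists gens"
    using generated by (simp add: finitely_1_generated_def)
  then obtain ss where "ss \<in> lists gens" and t: "t = prod_list ss" by blast
  from this(1) show ?thesis
    unfolding t by (induction ss) (use assms in auto)
qed

lemma deg_SucE:
  assumes "deg t = Suc n"
  obtains s u where "s \<in> gens" "deg u = n" "t = s * u"
proof -
  have "deg t = Suc n \<Longrightarrow> \<exists>s\<in>gens. \<exists>u. deg u = n \<and> t = s * u"
  proof (induction t rule: gens_induct)
    case (mult s t)
    then have "deg t = n" by (simp add: deg_gen)
    with mult.hyps show ?case by blast
  qed simp
  with assms that show ?thesis by blast
qed

lemma deg_eq_0_iff [simp]: "deg t = 0 \<longleftrightarrow> t = 1"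
proof
  show "deg t = 0 \<Longrightarrow> t = 1" by (induction t rule: gens_induct) (simp_all add: deg_gen)
qed simp

text \<open>By \<open>deg_SucE\<close>, each degree adds one factor from the finite set
  \<open>gens\<close>. This supplies the finite nets in
  \<open>orbit_closure_compact\<close>.\<close>

lemma finite_graded_piece: "finite (graded_piece deg n)"
proof (induction n)
  case 0
  show ?case by (simp add: graded_piece_def)
next
  case (Suc n)
  have "graded_piece deg (Suc n) \<subseteq> (\<lambda>(s, u). s * u) ` (gens \<times> graded_piece deg n)"
  proof
    fix t assume "t \<in> graded_piece deg (Suc n)"
    then have "deg t = Suc n" by (simp add: graded_piece_def)
    then obtain s u where "s \<in> gens" "deg u = n" "t = s * u" by (rule deg_SucE)
    then show "t \<in> (\<lambda>(s, u). s * u) ` (gens \<times> graded_piece deg n)"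
      by (intro image_eqI[of _ _ "(s, u)"]) (auto simp: graded_piece_def)
  qed
  then show ?case
    by (rule finite_subset) (intro finite_imageI finite_cartesian_product finite_gens Suc)
qed

lemma split_prefix:
  assumes "n \<le> deg t"
  shows "\<exists>a b. deg a = n \<and> t = a * b"
  using assms
proof (induction n arbitrary: t)
  case 0
  then show ?case using deg_one mult_1_left by metis
next
  case (Suc n)
  from Suc.prems obtain m where "deg t = Suc m" "n \<le> m" using Suc_le_D by fastforce
  then obtain s u where su: "s \<in> gens" "n \<le> deg u" "t = s * u" using deg_SucE by blast
  then obtain a b where "deg a = n" "u = a * b" using Suc.IH by blast
  with su have "deg (s * a) = Suc n \<and> t = s * a * b" by (simp add: deg_gen mult.assoc)
  then show ?case by blast
qed

text \<open>Descending in the order means multiplying on the right: the larger element is a left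
  factor of the smaller one.\<close>

lemma monoid_le_iff: "monoid_le x y \<longleftrightarrow> (\<exists>z. x = y * z)"
proof
  assume "monoid_le x y"
  then have "x * 1 \<in> range ((*) y)" unfolding monoid_le_def by blast
  then show "\<exists>z. x = y * z" by auto
next
  assume "\<exists>z. x = y * z"
  then show "monoid_le x y" by (auto simp: monoid_le_def mult.assoc)
qed

lemma monoid_le_refl [simp]: "monoid_le (x::'m) x"
  by (simp add: monoid_le_def)

lemma monoid_le_trans: "monoid_le (x::'m) y \<Longrightarrow> monoid_le y z \<Longrightarrow> monoid_le x z"
  by (auto simp: monoid_le_def)

lemma le_deg: "monoid_le x y \<Longrightarrow> deg y \<le> deg x"
  by (auto simp: monoid_le_iff)

text \<open>The right factor has degree 0, hence is 1. Thus every strict descent raises the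
  degree.\<close>

lemma le_eq_if_deg_le: "monoid_le x y \<Longrightarrow> deg x \<le> deg y \<Longrightarrow> x = y"
  by (auto simp: monoid_le_iff)

section \<open>Decreasing sequences and their equivalence\<close>

abbreviation D :: "(nat \<Rightarrow> 'm) set" where
  "D \<equiv> decreasing_seqs monoid_le"

text \<open>On \<open>D\<close> this amounts to plain unboundedness, by
  \<open>unbounded_degI\<close>; the filter form composes directly with the limit of \<delta> ^
  n.\<close>

definition unbounded_deg :: "(nat \<Rightarrow> 'm) \<Rightarrow> bool" where
  "unbounded_deg u \<longleftrightarrow> filterlim (\<lambda>n. deg (u n)) at_top sequentially"

lemma decreasingD: "u \<in> D \<Longrightarrow> n \<le> k \<Longrightarrow> monoid_le (u k) (u n)"
  by (auto simp: decreasing_seqs_def)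

lemma const_decreasing [simp]: "(\<lambda>_. t) \<in> D"
  by (simp add: decreasing_seqs_def)

lemma seq_le_refl: "seq_le monoid_le (u::nat \<Rightarrow> 'm) u"
  unfolding seq_le_def using monoid_le_refl by blast

lemma seq_le_trans:
  fixes u v w :: "nat \<Rightarrow> 'm"
  shows "seq_le monoid_le u v \<Longrightarrow> seq_le monoid_le v w \<Longrightarrow> seq_le monoid_le u w"
  unfolding seq_le_def by (meson monoid_le_trans)

lemma unbounded_degI:
  assumes u: "u \<in> D" and *: "\<And>N. \<exists>n. N \<le> deg (u n)"
  shows "unbounded_deg u"
  unfolding unbounded_deg_def filterlim_at_top eventually_sequentially
proof
  fix N
  obtain n where "N \<le> deg (u n)" using * by blast
  then show "\<exists>k. \<forall>n\<ge>k. N \<le> deg (u n)"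
    using decreasingD[OF u] le_deg order.trans by blast
qed

lemma unbounded_degD: "unbounded_deg u \<Longrightarrow> \<exists>n. N \<le> deg (u n)"
  by (auto simp: unbounded_deg_def filterlim_at_top eventually_sequentially)

text \<open>A bounded degree attains its maximum at some \<open>k\<close>; later terms lie below
  \<open>u k\<close> without larger degree, so they coincide with it.\<close>

lemma eventually_const:
  assumes u: "u \<in> D" and bound: "\<And>n. deg (u n) \<le> N"
  obtains k where "\<And>n. n \<ge> k \<Longrightarrow> u n = u k"
proof -
  have "\<exists>k. \<forall>n. deg (u n) \<le> deg (u k)"
    \<comment> \<open>The rule asks for a strict bound, hence \<open>Suc N\<close>.\<close>
    using ex_has_greatest_nat[of "\<lambda>_. True" 0 "\<lambda>n. deg (u n)" "Suc N"] bound
    by (simp add: less_Suc_eq_le)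
  then show ?thesis using that u decreasingD le_eq_if_deg_le by blast
qed

lemma eventually_const_min:
  assumes u: "u \<in> D" and k: "\<And>n. n \<ge> k \<Longrightarrow> u n = u k"
  shows "monoid_le (u k) (u n)"
proof (cases "n \<le> k")
  case False
  then show ?thesis using k[of n] by simp
qed (rule decreasingD[OF u])

text \<open>An infimum of a decreasing sequence is attained, so the second clause of \<^const>\<open>seq_sim\<close>
  adds nothing.\<close>

lemma seq_sim_iff:
  "seq_sim monoid_le u v \<longleftrightarrow>
     u \<in> D \<and> v \<in> D \<and> seq_le monoid_le u v \<and> seq_le monoid_le v u"
proof -
  have "seq_le monoid_le u (\<lambda>_. m)" if u: "u \<in> D" and m: "is_seq_min monoid_le m u" for m
  proof -
    have "deg (u n) \<le> deg m" for n
      using m by (auto simp: is_seq_min_def le_deg)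
    then obtain k where k: "\<And>n. n \<ge> k \<Longrightarrow> u n = u k" using eventually_const[OF u] by blast
    \<comment> \<open>The stable value \<open>u k\<close> is itself a lower bound of
      \<open>u\<close>, so it lies below the infimum \<open>m\<close>.\<close>
    have "monoid_le (u k) m"
      using m eventually_const_min[OF u k] by (auto simp: is_seq_min_def)
    then show ?thesis by (auto simp: seq_le_def)
  qed
  then show ?thesis by (auto simp: seq_sim_def)
qed

text \<open>By \<open>seq_sim_iff\<close> the relation is already the symmetric part of a preorder
  on \<open>D\<close>, so generating an equivalence from it adds no pairs.\<close>

lemma seq_equiv_iff:
  "(u, v) \<in> seq_equiv monoid_le \<longleftrightarrow>
     u \<in> D \<and> v \<in> D \<and> seq_le monoid_le u v \<and> seq_le monoid_le v u"
proof
  assume "(u, v) \<in> seq_equiv monoid_le"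
  then have uv: "u \<in> D" "v \<in> D" and "equivclp (seq_sim monoid_le) u v"
    by (auto simp: seq_equiv_def)
  from this(3) have "seq_le monoid_le u v \<and> seq_le monoid_le v u"
    by (induction rule: equivclp_induct) (auto simp: seq_sim_iff intro: seq_le_refl seq_le_trans)
  with uv show "u \<in> D \<and> v \<in> D \<and> seq_le monoid_le u v \<and> seq_le monoid_le v u" by simp
next
  assume "u \<in> D \<and> v \<in> D \<and> seq_le monoid_le u v \<and> seq_le monoid_le v u"
  then show "(u, v) \<in> seq_equiv monoid_le"
    by (auto simp: seq_equiv_def seq_sim_iff intro: r_into_equivclp)
qed

lemma equiv_seq_equiv: "equiv D (seq_equiv monoid_le)"
proof (rule equivI)
  show "seq_equiv monoid_le \<subseteq> D \<times> D" by (auto simp: seq_equiv_iff)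
  show "refl_on D (seq_equiv monoid_le)"
    by (auto simp: refl_on_def seq_equiv_iff seq_le_refl)
  show "sym (seq_equiv (monoid_le :: 'm \<Rightarrow> 'm \<Rightarrow> bool))"
    by (auto simp: sym_def seq_equiv_iff)
  show "trans (seq_equiv (monoid_le :: 'm \<Rightarrow> 'm \<Rightarrow> bool))"
    by (auto simp: trans_def seq_equiv_iff intro: seq_le_trans)
qed

section \<open>Boundary points and their representatives\<close>

abbreviation bdry :: "(nat \<Rightarrow> 'm) set set" where
  "bdry \<equiv> poset_boundary monoid_le"

text \<open>If the degrees along \<open>u\<close> were bounded, \<open>u\<close> would become
  constant and its class would be the embedded point \<open>u k\<close>, which is not in the
  boundary.\<close>

lemma boundary_memD:
  assumes A: "A \<in> bdry" and u: "u \<in> A"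
  shows "u \<in> D" "unbounded_deg u" "v \<in> A \<Longrightarrow> seq_le monoid_le u v"
proof -
  obtain a where a: "a \<in> D" "A = seq_equiv monoid_le `` {a}" "A \<notin> range (bar_embed monoid_le)"
    using A by (auto simp: poset_boundary_def poset_bar_def elim: quotientE)
  then have au: "(a, u) \<in> seq_equiv monoid_le" using u by simp
  then show uD: "u \<in> D" by (simp add: seq_equiv_iff)
  show "seq_le monoid_le u v" if "v \<in> A"
    using au that a(2) by (auto simp: seq_equiv_iff intro: seq_le_trans)
  show "unbounded_deg u"
  proof (rule ccontr)
    assume "\<not> unbounded_deg u"
    then obtain N where "\<not> (\<exists>n. N \<le> deg (u n))"
      using unbounded_degI[OF uD] by blast
    then have "deg (u n) \<le> N" for n by (meson nle_le)
    then obtain k where k: "\<And>n. n \<ge> k \<Longrightarrow> u n = u k" using eventually_const[OF uD] by blast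
    have "(u, \<lambda>_. u k) \<in> seq_equiv monoid_le"
      using eventually_const_min[OF uD k] uD by (auto simp: seq_equiv_iff seq_le_def intro: monoid_le_refl)
    then have "(a, \<lambda>_. u k) \<in> seq_equiv monoid_le"
      using au by (auto simp: seq_equiv_iff intro: seq_le_trans)
    then have "A = bar_embed monoid_le (u k)"
      unfolding a bar_embed_def by (rule equiv_class_eq[OF equiv_seq_equiv])
    with a(3) show False by blast
  qed
qed

text \<open>If the class were that of a constant sequence \<open>t\<close>, all degrees along
  \<open>u\<close> would be at most \<open>deg t\<close>.\<close>

lemma boundary_classI:
  assumes u: "u \<in> D" and unb: "unbounded_deg u"
  shows "seq_equiv monoid_le `` {u} \<in> bdry" "u \<in> seq_equiv monoid_le `` {u}"
proof -
  show "u \<in> seq_equiv monoid_le `` {u}" using u by (simp add: seq_equiv_iff seq_le_refl)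
  have "seq_equiv monoid_le `` {u} \<noteq> bar_embed monoid_le t" for t
  proof
    assume "seq_equiv monoid_le `` {u} = bar_embed monoid_le t"
    then have "seq_le monoid_le (\<lambda>_. t) u"
      unfolding bar_embed_def
      using u equiv_class_eq_iff[OF equiv_seq_equiv] seq_equiv_iff by blast
    then have "deg (u n) \<le> deg t" for n by (auto simp: seq_le_def le_deg)
    moreover obtain n where "Suc (deg t) \<le> deg (u n)" using unbounded_degD[OF unb] by blast
    ultimately show False by (meson not_less_eq_eq)
  qed
  then show "seq_equiv monoid_le `` {u} \<in> bdry"
    using u by (auto simp: poset_boundary_def poset_bar_def quotientI)
qed

lemma strictly_decreasing:
  assumes f: "strictly_decreasing monoid_le f"
  shows "f \<in> D" "unbounded_deg f"
proof -
  have "monoid_le (f k) (f n)" if "n \<le> k" for n k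
    using that
  proof (induction rule: dec_induct)
    case (step k)
    then show ?case using f monoid_le_trans unfolding strictly_decreasing_def by blast
  qed simp
  then show fD: "f \<in> D" by (simp add: decreasing_seqs_def)
  have "deg (f n) < deg (f (Suc n))" for n
    using f le_eq_if_deg_le not_le unfolding strictly_decreasing_def by metis
  then have "n \<le> deg (f n)" for n
    by (induction n) (auto simp: Suc_le_eq intro: le_less_trans)
  then show "unbounded_deg f" using unbounded_degI[OF fD] by blast
qed

text \<open>A subsequence along which the degree increases strictly is strictly decreasing, and it
  is equivalent to the original sequence.\<close>

lemma ex_strictly_decreasing:
  assumes A: "A \<in> bdry"
  shows "\<exists>f\<in>A. strictly_decreasing monoid_le f"
proof -
  obtain u where A_eq: "A = seq_equiv monoid_le `` {u}" and u: "u \<in> D"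
    using A by (auto simp: poset_boundary_def poset_bar_def elim: quotientE)
  then have "u \<in> A" by (simp add: seq_equiv_iff seq_le_refl)
  then have unb: "unbounded_deg u" using A boundary_memD by blast
  have "\<exists>k'. k < k' \<and> deg (u k) < deg (u k')" for k
  proof -
    obtain k' where "Suc (deg (u k)) \<le> deg (u k')" using unbounded_degD[OF unb] by blast
    moreover from this have "k < k'"
      using le_deg[OF decreasingD[OF u, of k' k]] by (meson not_less_eq_eq not_le)
    ultimately show ?thesis by auto
  qed
  \<comment> \<open>\<open>r k\<close> is a later index of larger degree; iterating \<open>r\<close>
    from 0 gives the subsequence \<open>g\<close>.\<close>
  then obtain r where r: "\<And>k. k < r k" "\<And>k. deg (u k) < deg (u (r k))" by metis
  define g where "g n = (r ^^ n) 0" for n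
  have g: "g n < g (Suc n)" "deg (u (g n)) < deg (u (g (Suc n)))" for n
    using r by (auto simp: g_def)
  then have "strict_mono g" by (simp add: strict_mono_Suc_iff)
  then have n_le: "n \<le> g n" for n by (rule seq_suble)
  have sd: "strictly_decreasing monoid_le (u \<circ> g)"
    unfolding strictly_decreasing_def o_def
    using g decreasingD[OF u] by (metis less_imp_le less_irrefl)
  have "seq_le monoid_le u (u \<circ> g)" "seq_le monoid_le (u \<circ> g) u"
    unfolding seq_le_def o_def using monoid_le_refl decreasingD[OF u n_le] by blast+
  then have "u \<circ> g \<in> A"
    using u strictly_decreasing(1)[OF sd] by (simp add: A_eq seq_equiv_iff)
  with sd show ?thesis by blast
qed

text \<open>\<open>bar_le\<close> provides just one comparable pair of representatives; transitivity
  moves the comparison to the given \<open>f\<close> and the constant sequence.\<close>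

lemma bar_cone_memD:
  assumes "A \<in> bdry" "f \<in> A" "A \<in> bar_cone monoid_le t"
  shows "seq_le monoid_le f (\<lambda>_. t)"
proof -
  obtain u v where "u \<in> A" "v \<in> bar_embed monoid_le t" "seq_le monoid_le u v"
    using assms(3) by (auto simp: bar_cone_def bar_le_def)
  moreover from this have "seq_le monoid_le v (\<lambda>_. t)"
    by (auto simp: bar_embed_def seq_equiv_iff)
  ultimately show ?thesis using boundary_memD(3)[OF assms(1,2)] seq_le_trans by blast
qed

lemma bar_cone_memI:
  assumes "A \<in> bdry" "f \<in> A"
  shows "A \<in> bar_cone monoid_le (f n)"
proof -
  have "(\<lambda>_. f n) \<in> bar_embed monoid_le (f n)"
    by (simp add: bar_embed_def seq_equiv_iff seq_le_refl)
  moreover have "seq_le monoid_le f (\<lambda>_. f n)" by (auto simp: seq_le_def intro: monoid_le_refl)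
  ultimately show ?thesis
    using assms by (auto simp: bar_cone_def bar_le_def poset_boundary_def)
qed

lemma openin_bar_cone: "openin (cone_boundary monoid_le) (bdry \<inter> bar_cone monoid_le (t::'m))"
  unfolding cone_boundary_def cone_topology_def
  by (intro openin_subtopology_Int2 topology_generated_by_Basis) blast

end

section \<open>Contracting representations and their attractor\<close>

locale contracting_rep = fg_graded_monoid deg
  for deg :: "'m::monoid_mult \<Rightarrow> nat" +
  fixes \<alpha> :: "'m \<Rightarrow> 'x::complete_space \<Rightarrow> 'x" and \<delta> :: real
  assumes rep: "continuous_representation \<alpha>"
    and delta: "0 < \<delta>" "\<delta> < 1"
    and contr: "\<And>s x y. s \<in> graded_piece deg 1 \<Longrightarrow> dist (\<alpha> s x) (\<alpha> s y) \<le> \<delta> * dist x y"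
begin

section \<open>Contraction estimates and bounded orbits\<close>

lemma act_one [simp]: "\<alpha> 1 x = x"
  and act_mult: "\<alpha> (s * t) x = \<alpha> s (\<alpha> t x)"
  using rep by (auto simp: continuous_representation_def)

lemma continuous_act: "continuous_on S (\<alpha> s)"
  using rep continuous_on_subset unfolding continuous_representation_def by blast

lemma dist_act: "dist (\<alpha> t x) (\<alpha> t y) \<le> \<delta> ^ deg t * dist x y"
proof (induction t rule: gens_induct)
  case (mult s t)
  have "dist (\<alpha> (s * t) x) (\<alpha> (s * t) y) \<le> \<delta> * dist (\<alpha> t x) (\<alpha> t y)"
    unfolding act_mult by (rule contr[OF mult.hyps])
  also have "\<dots> \<le> \<delta> * (\<delta> ^ deg t * dist x y)"
    using mult.IH delta by (intro mult_left_mono) auto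
  finally show ?case using mult.hyps by (simp add: deg_gen mult.assoc)
qed simp

lemma power_deg_tendsto_0:
  assumes "unbounded_deg u"
  shows "(\<lambda>n. \<delta> ^ deg (u n) * C) \<longlonglongrightarrow> 0"
proof -
  have "(\<lambda>n. \<delta> ^ n) \<longlonglongrightarrow> 0" using delta by (intro LIMSEQ_realpow_zero) auto
  then have "(\<lambda>n. \<delta> ^ deg (u n)) \<longlonglongrightarrow> 0"
    using assms unfolding unbounded_deg_def by (rule filterlim_compose)
  then show ?thesis by (rule tendsto_mult_left_zero)
qed

text \<open>Serves both to change the base point of an orbit and, with \<open>w\<close> constant, to
  prove convergence from an explicit error bound.\<close>

lemma tendsto_if_dist_le:
  fixes v w :: "nat \<Rightarrow> 'x"
  assumes unb: "unbounded_deg u" and w: "w \<longlonglongrightarrow> y"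
    and le: "\<And>n. dist (v n) (w n) \<le> \<delta> ^ deg (u n) * C"
  shows "v \<longlonglongrightarrow> y"
proof -
  have "(\<lambda>n. \<delta> ^ deg (u n) * C + dist (w n) y) \<longlonglongrightarrow> 0 + dist y y"
    by (intro tendsto_intros power_deg_tendsto_0 unb w)
  then have lim: "(\<lambda>n. \<delta> ^ deg (u n) * C + dist (w n) y) \<longlonglongrightarrow> 0" by simp
  have "dist (v n) y \<le> \<delta> ^ deg (u n) * C + dist (w n) y" for n
    using dist_triangle[of "v n" y "w n"] le[of n] by linarith
  then have "(\<lambda>n. dist (v n) y) \<longlonglongrightarrow> 0"
    by (intro real_tendsto_sandwich[OF _ _ tendsto_const lim]) auto
  then show ?thesis by (rule tendsto_dist_iff[THEN iffD2])
qed

lemma ex_power_less: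
  assumes "\<epsilon> > 0" shows "\<exists>n. \<delta> ^ n * C < \<epsilon>"
proof -
  have "(\<lambda>n. \<delta> ^ n * C) \<longlonglongrightarrow> 0"
    using delta by (intro tendsto_mult_left_zero LIMSEQ_realpow_zero) auto
  then have "eventually (\<lambda>n. \<delta> ^ n * C < \<epsilon>) sequentially"
    using assms by (rule order_tendstoD(2))
  then show ?thesis by (auto simp: eventually_sequentially)
qed

lemma orbit_bounded: "\<exists>R. \<forall>t. dist (\<alpha> t x) x \<le> R"
proof -
  define C where "C = (\<Sum>s\<in>gens. dist (\<alpha> s x) x)"
  have C: "dist (\<alpha> s x) x \<le> C" if "s \<in> gens" for s
    unfolding C_def using that finite_gens by (intro member_le_sum) auto
  have C0: "0 \<le> C" unfolding C_def by (intro sum_nonneg) auto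
  \<comment> \<open>\<open>R\<close> is the solution of \<open>\<delta> * R + C = R\<close>, so the
    bound survives prepending one more generator.\<close>
  define R where "R = C / (1 - \<delta>)"
  have R0: "0 \<le> R" and R: "\<delta> * R + C = R"
    using C0 delta by (auto simp: R_def field_simps)
  have "dist (\<alpha> t x) x \<le> R" for t
  proof (induction t rule: gens_induct)
    case (mult s t)
    have "dist (\<alpha> (s * t) x) x \<le> dist (\<alpha> s (\<alpha> t x)) (\<alpha> s x) + dist (\<alpha> s x) x"
      by (simp add: act_mult dist_triangle)
    also have "\<dots> \<le> \<delta> * dist (\<alpha> t x) x + C"
      by (intro add_mono contr C mult.hyps)
    also have "\<dots> \<le> \<delta> * R + C"
      using mult.IH delta by simp
    finally show ?case by (simp add: R)
  qed (simp add: R0)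
  then show ?thesis by blast
qed

section \<open>Invariant compact sets: uniqueness and existence\<close>

lemma invariant_act:
  assumes K: "K = (\<Union>s\<in>gens. \<alpha> s ` K)" and "q \<in> K"
  shows "\<alpha> t q \<in> K"
proof (induction t rule: gens_induct)
  case (mult s t)
  then have "\<alpha> s (\<alpha> t q) \<in> (\<Union>s\<in>gens. \<alpha> s ` K)" by blast
  then show ?case unfolding act_mult using K by blast
qed (simp add: assms(2))

text \<open>Unfolding the fixed point equation \<open>n\<close> times writes a point of
  \<open>K\<close> as the image of another point of \<open>K\<close> under a word of length
  \<open>n\<close>.\<close>

lemma invariant_preimage:
  assumes K: "K = (\<Union>s\<in>gens. \<alpha> s ` K)"
  shows "y \<in> K \<Longrightarrow> \<exists>t q. deg t = n \<and> q \<in> K \<and> y = \<alpha> t q"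
proof (induction n arbitrary: y)
  case 0
  then have "deg 1 = 0 \<and> y \<in> K \<and> y = \<alpha> 1 y" by simp
  then show ?case by blast
next
  case (Suc n)
  from Suc.prems obtain s z where sz: "s \<in> gens" "z \<in> K" "y = \<alpha> s z" using K by blast
  then obtain t q where "deg t = n" "q \<in> K" "z = \<alpha> t q" using Suc.IH by blast
  with sz have "deg (s * t) = Suc n \<and> q \<in> K \<and> y = \<alpha> (s * t) q" by (simp add: deg_gen act_mult)
  then show ?case by blast
qed

text \<open>For \<open>y = \<alpha> t q\<close> with \<open>t\<close> long, the point
  \<open>\<alpha> t l\<close> of \<open>L\<close> is close to \<open>y\<close>, and \<open>L\<close>
  is closed. Applied in both directions this gives uniqueness of the attractor.\<close>

lemma invariant_subset:
  assumes K: "compact K" "K = (\<Union>s\<in>gens. \<alpha> s ` K)"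
    and L: "compact L" "L \<noteq> {}" "L = (\<Union>s\<in>gens. \<alpha> s ` L)"
  shows "K \<subseteq> L"
proof
  fix y assume y: "y \<in> K"
  obtain l where l: "l \<in> L" using L by blast
  obtain C where C: "\<And>q. q \<in> K \<Longrightarrow> dist l q \<le> C"
    using compact_imp_bounded[OF K(1)] bounded_any_center[of K l] by auto
  have "\<exists>z\<in>L. dist z y < \<epsilon>" if \<epsilon>: "\<epsilon> > 0" for \<epsilon>
  proof -
    obtain n where n: "\<delta> ^ n * C < \<epsilon>" using ex_power_less[OF \<epsilon>] by blast
    obtain t q where tq: "deg t = n" "q \<in> K" "y = \<alpha> t q"
      using invariant_preimage[OF K(2) y] by blast
    have "dist (\<alpha> t l) y \<le> \<delta> ^ n * dist l q"
      using dist_act[of t l q] tq by simp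
    also have "\<dots> \<le> \<delta> ^ n * C"
      using C[OF tq(2)] delta by (intro mult_left_mono) auto
    finally show ?thesis using n invariant_act[OF L(3) l] by (meson le_less_trans)
  qed
  then have "y \<in> closure L" by (simp add: closure_approachable)
  then show "y \<in> L" using L(1) by (simp add: compact_imp_closed)
qed

text \<open>Long words act on \<open>p\<close> almost like their prefixes of length
  \<open>n\<close>, so the finitely many words of degree at most \<open>n\<close> yield a net.
  Completeness of the space does the rest.\<close>

lemma orbit_closure_compact: "compact (closure (range (\<lambda>t. \<alpha> t p)))"
proof -
  let ?O = "range (\<lambda>t. \<alpha> t p)"
  obtain R where R: "\<And>t. dist (\<alpha> t p) p \<le> R" using orbit_bounded by blast
  have "\<exists>F. finite F \<and> closure ?O \<subseteq> (\<Union>z\<in>F. ball z \<epsilon>)" if \<epsilon>: "\<epsilon> > 0" for \<epsilon>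
  proof -
    obtain n where n: "\<delta> ^ n * R < \<epsilon> / 2" using ex_power_less[of "\<epsilon> / 2"] \<epsilon> by auto
    define F where "F = (\<lambda>t. \<alpha> t p) ` (\<Union>k\<le>n. graded_piece deg k)"
    have fin: "finite F" unfolding F_def by (auto simp: finite_graded_piece)
    have "?O \<subseteq> (\<Union>z\<in>F. cball z (\<epsilon> / 2))"
    proof
      fix y assume "y \<in> ?O"
      then obtain t where t: "y = \<alpha> t p" by blast
      show "y \<in> (\<Union>z\<in>F. cball z (\<epsilon> / 2))"
      proof (cases "deg t \<le> n")
        case True
        then have "y \<in> F" by (auto simp: F_def t graded_piece_def)
        then show ?thesis using \<epsilon> by force
      next
        case False
        then obtain a b where ab: "deg a = n" "t = a * b" using split_prefix[of n t] by auto
        then have "\<alpha> a p \<in> F" by (auto simp: F_def graded_piece_def)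
        moreover have "dist (\<alpha> a p) y \<le> \<delta> ^ n * dist p (\<alpha> b p)"
          using dist_act[of a p "\<alpha> b p"] by (simp add: t ab act_mult)
        moreover have "\<delta> ^ n * dist p (\<alpha> b p) \<le> \<delta> ^ n * R"
          using R[of b] delta by (intro mult_left_mono) (auto simp: dist_commute)
        ultimately show ?thesis using n by force
      qed
    qed
    \<comment> \<open>A finite union of closed balls is closed and so absorbs the closure; the
      radius \<open>\<epsilon> / 2\<close> leaves room for open balls of radius \<epsilon>.\<close>
    then have "closure ?O \<subseteq> (\<Union>z\<in>F. cball z (\<epsilon> / 2))"
      by (rule closure_minimal) (auto intro: closed_UN fin)
    also have "\<dots> \<subseteq> (\<Union>z\<in>F. ball z \<epsilon>)" using \<epsilon> by (intro UN_mono) auto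
    finally show ?thesis using fin by blast
  qed
  then show ?thesis
    by (auto simp: compact_eq_totally_bounded complete_eq_closed)
qed

text \<open>The candidate is the orbit closure of the fixed point \<open>p\<close> of one generator;
  without generators the empty set works.\<close>

lemma ex_attractor:
  "\<exists>K. compact K \<and> (gens \<noteq> {} \<longrightarrow> K \<noteq> {}) \<and> K = (\<Union>s\<in>gens. \<alpha> s ` K)"
proof (cases "gens = {}")
  case False
  then obtain s where s: "s \<in> gens" by blast
  have "\<exists>!p. \<alpha> s p = p"
    by (rule banach_fix_type[of \<delta>]) (use delta contr[OF s] in auto)
  then obtain p where p: "\<alpha> s p = p" by blast
  let ?O = "range (\<lambda>t. \<alpha> t p)"
  let ?U = "\<Union>s\<in>gens. \<alpha> s ` closure ?O"
  have orb: "\<alpha> t p \<in> closure ?O" for t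
    by (rule subsetD[OF closure_subset]) (rule rangeI)
  have "\<alpha> t p \<in> ?U" for t
  proof (cases "t = 1")
    case True
    \<comment> \<open>The empty word has no first letter, but \<open>p = \<alpha> s p\<close> still
      exhibits \<open>p\<close> as the image of an orbit point.\<close>
    have "\<alpha> s (\<alpha> 1 p) \<in> ?U" using s orb[of 1] by blast
    then show ?thesis using p True by simp
  next
    case False
    then have "deg t \<noteq> 0" by simp
    then obtain n where "deg t = Suc n" using not0_implies_Suc by blast
    then obtain s' u where su: "s' \<in> gens" "t = s' * u" by (rule deg_SucE)
    have "\<alpha> s' (\<alpha> u p) \<in> ?U" using su(1) orb[of u] by blast
    then show ?thesis by (simp only: su(2) act_mult)
  qed
  then have "?O \<subseteq> ?U" by blast
  moreover have "compact ?U"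
    by (intro compact_UN finite_gens compact_continuous_image continuous_act orbit_closure_compact)
  ultimately have "closure ?O \<subseteq> ?U"
    by (intro closure_minimal compact_imp_closed)
  moreover have "\<alpha> s' ` closure ?O \<subseteq> closure ?O" for s'
  proof -
    have "\<alpha> s' ` ?O \<subseteq> closure ?O"
      using orb by (simp add: image_subset_iff flip: act_mult)
    then show ?thesis by (intro image_closure_subset continuous_act closed_closure)
  qed
  ultimately have "closure ?O = ?U" by blast
  moreover have "closure ?O \<noteq> {}" by simp
  ultimately show ?thesis using orbit_closure_compact by blast
qed auto

text \<open>Existence and uniqueness together license the definite description in the definition of
  \<open>attractor\<close>.\<close>

lemma attractor:
  "compact (attractor deg \<alpha>)"
  "gens \<noteq> {} \<Longrightarrow> attractor deg \<alpha> \<noteq> {}"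
  "attractor deg \<alpha> = (\<Union>s\<in>gens. \<alpha> s ` attractor deg \<alpha>)"
proof -
  let ?P = "\<lambda>K. compact K \<and> (gens \<noteq> {} \<longrightarrow> K \<noteq> {}) \<and> K = (\<Union>s\<in>gens. \<alpha> s ` K)"
  have subset: "K \<subseteq> L" if "?P K" "?P L" for K L
  proof (cases "gens = {}")
    case True
    then have "(\<Union>s\<in>gens. \<alpha> s ` K) = {}" by simp
    with that(1) show ?thesis by blast
  next
    case False
    with that show ?thesis by (intro invariant_subset) blast+
  qed
  have "\<exists>!K. ?P K"
  proof (rule ex_ex1I[OF ex_attractor])
    show "K = L" if "?P K" "?P L" for K L
      using subset[OF that] subset[OF that(2,1)] by (rule equalityI)
  qed
  then have "?P (attractor deg \<alpha>)" unfolding attractor_def by (rule theI')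
  then show "compact (attractor deg \<alpha>)"
    "gens \<noteq> {} \<Longrightarrow> attractor deg \<alpha> \<noteq> {}"
    "attractor deg \<alpha> = (\<Union>s\<in>gens. \<alpha> s ` attractor deg \<alpha>)" by blast+
qed

section \<open>The boundary map\<close>

text \<open>From some index on \<open>u n = t * z\<close>, so \<open>\<alpha> (u n) x\<close> lies
  in the image under \<open>\<alpha> t\<close> of an orbit that stays within \<open>R\<close> of
  \<open>x\<close>. Independence of representatives and continuity both rest on this
  estimate.\<close>

lemma limit_near:
  assumes R: "\<And>t. dist (\<alpha> t x) x \<le> R"
    and u: "u \<in> D" and lim: "(\<lambda>n. \<alpha> (u n) x) \<longlonglongrightarrow> y" and le: "seq_le monoid_le u (\<lambda>_. t)"
  shows "dist y (\<alpha> t x) \<le> \<delta> ^ deg t * R"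
proof -
  obtain k where k: "monoid_le (u k) t" using le by (auto simp: seq_le_def)
  have "dist (\<alpha> (u n) x) (\<alpha> t x) \<le> \<delta> ^ deg t * R" if "n \<ge> k" for n
  proof -
    have "monoid_le (u n) t" using k decreasingD[OF u that] monoid_le_trans by blast
    then obtain z where z: "u n = t * z" by (auto simp: monoid_le_iff)
    have "dist (\<alpha> (u n) x) (\<alpha> t x) \<le> \<delta> ^ deg t * dist (\<alpha> z x) x"
      unfolding z act_mult by (rule dist_act)
    also have "\<dots> \<le> \<delta> ^ deg t * R" using R delta by (intro mult_left_mono) auto
    finally show ?thesis .
  qed
  then have "eventually (\<lambda>n. dist (\<alpha> (u n) x) (\<alpha> t x) \<le> \<delta> ^ deg t * R) sequentially"
    by (auto simp: eventually_sequentially)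
  then show ?thesis
    by (intro tendsto_upperbound[OF tendsto_dist[OF lim tendsto_const]]) auto
qed

text \<open>All terms after index \<open>k\<close> stay within
  \<open>\<delta> ^ deg (u k) * R\<close> of term \<open>k\<close>, so the sequence is
  Cauchy.\<close>

lemma act_convergent:
  assumes u: "u \<in> D" and unb: "unbounded_deg u"
  shows "convergent (\<lambda>n. \<alpha> (u n) x)"
proof -
  obtain R where R: "\<And>t. dist (\<alpha> t x) x \<le> R" using orbit_bounded by blast
  have "Cauchy (\<lambda>n. \<alpha> (u n) x)"
  proof (rule metric_CauchyI)
    fix \<epsilon> :: real assume "\<epsilon> > 0"
    then have "eventually (\<lambda>n. \<delta> ^ deg (u n) * R < \<epsilon> / 2) sequentially"
      by (intro order_tendstoD(2)[OF power_deg_tendsto_0[OF unb]]) auto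
    then obtain k where k: "\<delta> ^ deg (u k) * R < \<epsilon> / 2"
      by (auto simp: eventually_sequentially)
    have "dist (\<alpha> (u n) x) (\<alpha> (u k) x) < \<epsilon> / 2" if "n \<ge> k" for n
    proof -
      obtain z where z: "u n = u k * z" using decreasingD[OF u \<open>n \<ge> k\<close>] by (auto simp: monoid_le_iff)
      have "dist (\<alpha> (u n) x) (\<alpha> (u k) x) \<le> \<delta> ^ deg (u k) * dist (\<alpha> z x) x"
        unfolding z act_mult by (rule dist_act)
      also have "\<dots> \<le> \<delta> ^ deg (u k) * R" using R delta by (intro mult_left_mono) auto
      finally show ?thesis using k by simp
    qed
    then show "\<exists>M. \<forall>m\<ge>M. \<forall>n\<ge>M. dist (\<alpha> (u m) x) (\<alpha> (u n) x) < \<epsilon>"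
      using dist_triangle_half_l by blast
  qed
  then show ?thesis by (rule Cauchy_convergent)
qed

text \<open>Each \<open>v n\<close> lies above some term of \<open>u\<close>, so
  \<open>limit_near\<close> with \<open>t = v n\<close> bounds the distance from
  \<open>\<alpha> (v n) x\<close> to the limit along \<open>u\<close>.\<close>

lemma limit_independent:
  assumes u: "u \<in> D" and lim: "(\<lambda>n. \<alpha> (u n) x) \<longlonglongrightarrow> y"
    and v: "unbounded_deg v" and le: "seq_le monoid_le u v"
  shows "(\<lambda>n. \<alpha> (v n) x) \<longlonglongrightarrow> y"
proof -
  obtain R where R: "\<And>t. dist (\<alpha> t x) x \<le> R" using orbit_bounded by blast
  have "dist (\<alpha> (v n) x) y \<le> \<delta> ^ deg (v n) * R" for n
  proof -
    have "seq_le monoid_le u (\<lambda>_. v n)" using le by (auto simp: seq_le_def)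
    then show ?thesis using limit_near[OF R u lim] by (simp add: dist_commute)
  qed
  then show ?thesis by (rule tendsto_if_dist_le[OF v tendsto_const])
qed

text \<open>All representatives share one limit, and a strictly decreasing one exists, so the
  definite description in \<open>boundary_map\<close> is well defined.\<close>

lemma boundary_map_limit:
  assumes A: "A \<in> bdry" and g: "g \<in> A"
  shows "(\<lambda>n. \<alpha> (g n) x) \<longlonglongrightarrow> boundary_map \<alpha> x A"
proof -
  note mem = boundary_memD[OF A]
  obtain y where y: "(\<lambda>n. \<alpha> (g n) x) \<longlonglongrightarrow> y"
    using act_convergent[OF mem(1,2)[OF g]] unfolding convergent_def by blast
  have lim: "(\<lambda>n. \<alpha> (f n) x) \<longlonglongrightarrow> y" if "f \<in> A" for f
    using limit_independent[OF _ y] mem g that by blast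
  obtain f where f: "f \<in> A" "strictly_decreasing monoid_le f"
    using ex_strictly_decreasing[OF A] by blast
  have "boundary_map \<alpha> x A = y"
    unfolding boundary_map_def using f lim LIMSEQ_unique by (intro the_equality) blast+
  with y show ?thesis by simp
qed

text \<open>Moving the base point from \<open>x\<close> to a point \<open>q\<close> of the attractor
  keeps the limit, and the orbit of \<open>q\<close> never leaves this closed set.\<close>

lemma boundary_map_in_attractor:
  assumes A: "A \<in> bdry"
  shows "boundary_map \<alpha> x A \<in> attractor deg \<alpha>"
proof -
  obtain f where f: "f \<in> A" using ex_strictly_decreasing[OF A] by blast
  have unb: "unbounded_deg f" using A f boundary_memD by blast
  \<comment> \<open>An element of positive degree forces a generator to exist, which makes the
    attractor nonempty.\<close>
  then obtain n where "1 \<le> deg (f n)" using unbounded_degD by blast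
  then obtain m where "deg (f n) = Suc m" using Suc_le_D by auto
  then have "gens \<noteq> {}" using deg_SucE by blast
  then obtain q where q: "q \<in> attractor deg \<alpha>" using attractor(2) by blast
  have "(\<lambda>n. \<alpha> (f n) q) \<longlonglongrightarrow> boundary_map \<alpha> x A"
    by (rule tendsto_if_dist_le[OF unb boundary_map_limit[OF A f] dist_act])
  then show ?thesis
    by (rule closed_sequentially[OF compact_imp_closed[OF attractor(1)], rotated])
      (rule invariant_act[OF attractor(3) q])
qed

text \<open>Boundary points in the cone of \<open>f n\<close> all have images within \<epsilon>/2 of
  \<open>\<alpha> (f n) x\<close> once \<open>n\<close> is large, and this cone is a neighbourhood
  of the class of \<open>f\<close>.\<close>

lemma continuous_boundary_map:
  "continuous_map (cone_boundary monoid_le) (top_of_set (attractor deg \<alpha>)) (boundary_map \<alpha> x)"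
proof -
  let ?T = "cone_boundary (monoid_le :: 'm \<Rightarrow> 'm \<Rightarrow> bool)"
  have top: "topspace ?T \<subseteq> bdry" by (simp add: cone_boundary_def)
  obtain R where R: "\<And>t. dist (\<alpha> t x) x \<le> R" using orbit_bounded by blast
  have nbhd: "\<exists>U. openin ?T U \<and> A \<in> U \<and>
      (\<forall>B\<in>U. dist (boundary_map \<alpha> x A) (boundary_map \<alpha> x B) < \<epsilon>)"
    if A: "A \<in> bdry" and \<epsilon>: "\<epsilon> > 0" for A \<epsilon>
  proof -
    obtain f where f: "f \<in> A" using ex_strictly_decreasing[OF A] by blast
    have "unbounded_deg f" using A f boundary_memD by blast
    then have "eventually (\<lambda>n. \<delta> ^ deg (f n) * R < \<epsilon> / 2) sequentially"
      using \<epsilon> by (intro order_tendstoD(2)[OF power_deg_tendsto_0]) auto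
    then obtain n where n: "\<delta> ^ deg (f n) * R < \<epsilon> / 2"
      by (auto simp: eventually_sequentially)
    let ?U = "bdry \<inter> bar_cone monoid_le (f n)"
    have near: "dist (boundary_map \<alpha> x B) (\<alpha> (f n) x) < \<epsilon> / 2" if B: "B \<in> ?U" for B
    proof -
      obtain g where g: "g \<in> B" using B ex_strictly_decreasing by blast
      have "dist (boundary_map \<alpha> x B) (\<alpha> (f n) x) \<le> \<delta> ^ deg (f n) * R"
        using B g by (intro limit_near[OF R _ boundary_map_limit])
          (auto intro: boundary_memD bar_cone_memD)
      with n show ?thesis by simp
    qed
    have AU: "A \<in> ?U" using A f bar_cone_memI by blast
    have "dist (boundary_map \<alpha> x A) (boundary_map \<alpha> x B) < \<epsilon>" if "B \<in> ?U" for B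
      using near[OF AU] near[OF that] by (rule dist_triangle_half_l)
    with AU show ?thesis using openin_bar_cone by blast
  qed
  have "openin ?T {A \<in> topspace ?T. boundary_map \<alpha> x A \<in> V}" if V: "open V" for V
  proof (subst openin_subopen, intro ballI)
    fix A assume A: "A \<in> {A \<in> topspace ?T. boundary_map \<alpha> x A \<in> V}"
    then obtain \<epsilon> where \<epsilon>: "\<epsilon> > 0" "ball (boundary_map \<alpha> x A) \<epsilon> \<subseteq> V"
      using V open_contains_ball by blast
    obtain U where U: "openin ?T U" "A \<in> U"
        "\<forall>B\<in>U. dist (boundary_map \<alpha> x A) (boundary_map \<alpha> x B) < \<epsilon>"
      using nbhd[of A \<epsilon>] A top \<epsilon>(1) by blast
    moreover have "U \<subseteq> {A \<in> topspace ?T. boundary_map \<alpha> x A \<in> V}"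
      using U \<epsilon>(2) openin_subset[OF U(1)] by (auto simp: subset_iff)
    ultimately show "\<exists>U. openin ?T U \<and> A \<in> U \<and>
        U \<subseteq> {A \<in> topspace ?T. boundary_map \<alpha> x A \<in> V}" by blast
  qed
  then have "continuous_map ?T euclidean (boundary_map \<alpha> x)"
    by (simp add: continuous_map_def)
  then show ?thesis
    using top boundary_map_in_attractor by (auto simp: continuous_map_in_subtopology)
qed

lemma boundary_map_surj:
  assumes y: "y \<in> attractor deg \<alpha>"
  shows "y \<in> boundary_map \<alpha> x ` bdry"
proof -
  let ?K = "attractor deg \<alpha>"
  have "\<exists>s z. s \<in> gens \<and> z \<in> ?K \<and> q = \<alpha> s z" if "q \<in> ?K" for q
    using that attractor(3) by blast
  \<comment> \<open>Choice functions: \<open>s q\<close> is a first letter for \<open>q\<close>, and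
    \<open>z q\<close> the attractor point it is applied to.\<close>
  then obtain s z where sz: "\<And>q. q \<in> ?K \<Longrightarrow> s q \<in> gens \<and> z q \<in> ?K \<and> q = \<alpha> (s q) (z q)"
    by metis
  \<comment> \<open>\<open>r n\<close> is what remains of \<open>y\<close> after removing
    \<open>n\<close> letters; \<open>f n\<close> collects these letters, appended on the
    right.\<close>
  define r where "r n = (z ^^ n) y" for n
  have rK: "r n \<in> ?K" for n unfolding r_def by (induction n) (use y sz in auto)
  have r_Suc: "r n = \<alpha> (s (r n)) (r (Suc n))" for n using sz[OF rK[of n]] by (simp add: r_def)
  define f where "f = rec_nat 1 (\<lambda>n t. t * s (r n))"
  have f: "f 0 = 1" "f (Suc n) = f n * s (r n)" for n by (simp_all add: f_def)
  have gen: "deg (s (r n)) = 1" for n using sz[OF rK] deg_gen by blast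
  have y_eq: "y = \<alpha> (f n) (r n)" for n
    by (induction n) (use r_Suc in \<open>simp_all add: f act_mult r_def\<close>)
  have sd: "strictly_decreasing monoid_le f"
    unfolding strictly_decreasing_def
  proof
    fix n
    have "deg (f (Suc n)) \<noteq> deg (f n)" by (simp add: f gen)
    moreover have "monoid_le (f (Suc n)) (f n)" using f monoid_le_iff by blast
    ultimately show "monoid_le (f (Suc n)) (f n) \<and> f (Suc n) \<noteq> f n" by auto
  qed
  note cl = boundary_classI[OF strictly_decreasing[OF sd]]
  \<comment> \<open>The remainders \<open>r n\<close> vary with \<open>n\<close> but stay in the
    bounded attractor, so one constant controls \<open>dist x (r n)\<close>.\<close>
  obtain C where C: "\<And>q. q \<in> ?K \<Longrightarrow> dist x q \<le> C"
    using compact_imp_bounded[OF attractor(1)] bounded_any_center[of ?K x] by auto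
  have "dist (\<alpha> (f n) x) y \<le> \<delta> ^ deg (f n) * C" for n
  proof -
    have "dist (\<alpha> (f n) x) y \<le> \<delta> ^ deg (f n) * dist x (r n)"
      using dist_act[of "f n" x "r n"] y_eq[of n] by simp
    also have "\<dots> \<le> \<delta> ^ deg (f n) * C" using C[OF rK] delta by (intro mult_left_mono) auto
    finally show ?thesis .
  qed
  then have "(\<lambda>n. \<alpha> (f n) x) \<longlonglongrightarrow> y"
    by (rule tendsto_if_dist_le[OF strictly_decreasing(2)[OF sd] tendsto_const])
  then have "boundary_map \<alpha> x (seq_equiv monoid_le `` {f}) = y"
    using boundary_map_limit[OF cl] LIMSEQ_unique by blast
  with cl(1) show ?thesis by blast
qed

end

theorem theoremC:
  fixes deg :: "'m::monoid_mult \<Rightarrow> nat"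
    and \<alpha> :: "'m \<Rightarrow> 'x::complete_space \<Rightarrow> 'x"
    and x :: 'x
  assumes "graded_monoid deg"
    and "finitely_1_generated deg"
    and "continuous_representation \<alpha>"
    and "contracting deg \<alpha>"
  shows "(\<forall>A \<in> poset_boundary (monoid_le :: 'm \<Rightarrow> 'm \<Rightarrow> bool).
            (\<exists>f\<in>A. strictly_decreasing monoid_le f) \<and>
            (\<forall>f\<in>A. strictly_decreasing monoid_le f \<longrightarrow>
               (\<lambda>n. \<alpha> (f n) x) \<longlonglongrightarrow> boundary_map \<alpha> x A))
       \<and> continuous_map (cone_boundary monoid_le) (top_of_set (attractor deg \<alpha>))
            (boundary_map \<alpha> x)
       \<and> (T_regular (monoid_le :: 'm \<Rightarrow> 'm \<Rightarrow> bool) \<longrightarrow>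
            boundary_map \<alpha> x ` poset_boundary monoid_le = attractor deg \<alpha>)"
proof -
  obtain \<delta> :: real where "0 < \<delta>" "\<delta> < 1"
    and "\<And>s x y. s \<in> graded_piece deg 1 \<Longrightarrow> dist (\<alpha> s x) (\<alpha> s y) \<le> \<delta> * dist x y"
    using assms(4) unfolding contracting_def by blast
  with assms interpret contracting_rep deg \<alpha> \<delta>
    by unfold_locales
  have "boundary_map \<alpha> x ` bdry = attractor deg \<alpha>"
    using boundary_map_in_attractor boundary_map_surj by (intro equalityI image_subsetI subsetI)
  then show ?thesis
    using ex_strictly_decreasing boundary_map_limit continuous_boundary_map by simp
qed

end
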